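(* Let $f\in\mathcal{S}^*_B$ have logarithmic coefficients $\gamma_1,\gamma_2,\gamma_3,\dots$, and let $\mathcal{H}_{2,1}(F_f/2)=\gamma_1\gamma_3-\gamma_2^2$. Then $$|\mathcal{H}_{2,1}(F_f/2)|\le\frac1{16}.$$ This inequality is sharp, i.e. equality holds for some function in $\mathcal{S}^*_B$.
   Context: Let $\mathbb{D}=\{z\in\mathbb{C}:|z|<1\}$ and let $\mathcal{A}$ be the class of analytic functions $f$ on $\mathbb{D}$ with $f(0)=0$, $f'(0)=1$, written $f(z)=z+\sum_{n=2}^\infty a_nz^n$. For analytic functions $g,h$ on $\mathbb{D}$, $g\prec h$ ($g$ is subordinate to $h$) means $g(z)=h(w(z))$ on $\mathbb{D}$ for some analytic $w:\mathbb{D}\to\mathbb{D}$ with $w(0)=0$. Let $B(z)=\dfrac{1}{1-\log(1+z)}$ on $\mathbb{D}$ (principal branch of the logarithm), and let $$\mathcal{S}^*_B=\left\{f\in\mathcal{A}:\ \frac{zf'(z)}{f(z)}\prec B(z)\right\}.$$ The logarithmic coefficients $\gamma_n$ of $f$ are defined by $F_f(z)=\log\frac{f(z)}{z}=2\sum_{n=1}^\infty\gamma_nz^n$ (the branch vanishing at $z=0$). Thus $\gamma_1=\frac12a_2$, $\gamma_2=\frac12\left(a_3-\frac12a_2^2\right)$, $\gamma_3=\frac12\left(a_4-a_2a_3+\frac13a_2^3\right)$. *)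

theory Defs
  imports "HOL-Complex_Analysis.Complex_Analysis"
begin

abbreviation unit_disc :: "complex set" ("\<bbbD>") where
  "\<bbbD> \<equiv> ball 0 1"

definition class_A :: "(complex \<Rightarrow> complex) set" where
  "class_A = {f. f holomorphic_on \<bbbD> \<and> f 0 = 0 \<and> deriv f 0 = 1}"

definition subordinate :: "(complex \<Rightarrow> complex) \<Rightarrow> (complex \<Rightarrow> complex) \<Rightarrow> bool"
    (infix "\<prec>\<^sub>s" 50) where
  "g \<prec>\<^sub>s h \<longleftrightarrow> g holomorphic_on \<bbbD> \<and> h holomorphic_on \<bbbD> \<and>
     (\<exists>w. w holomorphic_on \<bbbD> \<and> w ` \<bbbD> \<subseteq> \<bbbD> \<and> w 0 = 0 \<and> (\<forall>z\<in>\<bbbD>. g z = h (w z)))"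

definition B :: "complex \<Rightarrow> complex" where
  "B z = 1 / (1 - Ln (1 + z))"

text \<open>The function z f'(z) / f(z) has a removable singularity at 0 for f in class A, with
  value 1 there; the plain Isabelle quotient would evaluate to 0 / 0 = 0.\<close>

definition zf'_over_f :: "(complex \<Rightarrow> complex) \<Rightarrow> complex \<Rightarrow> complex" where
  "zf'_over_f f z = (if z = 0 then 1 else z * deriv f z / f z)"

definition starlike_B :: "(complex \<Rightarrow> complex) set" where
  "starlike_B = {f \<in> class_A. zf'_over_f f \<prec>\<^sub>s B}"

text \<open>The branch of log (f(z) / z) that vanishes at 0. These conditions determine it uniquely on
  the disc, and it exists whenever f in class A has no zero in the disc other than 0 (see
  the lemma log_branch below).\<close>

definition log_branch :: "(complex \<Rightarrow> complex) \<Rightarrow> complex \<Rightarrow> complex" where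
  "log_branch f = (SOME F. F holomorphic_on \<bbbD> \<and> F 0 = 0 \<and>
     (\<forall>z\<in>\<bbbD> - {0}. exp (F z) = f z / z))"

text \<open>Half the Taylor coefficients at 0, since the branch above is
  \<open>2 * (\<Sum>n\<ge>1. \<gamma> n * z ^ n)\<close>.\<close>

definition log_coeff :: "(complex \<Rightarrow> complex) \<Rightarrow> nat \<Rightarrow> complex" where
  "log_coeff f n = fps_nth (fps_expansion (log_branch f) 0) n / 2"

lemma one_plus_nonpos_Reals:
  assumes "z \<in> \<bbbD>"
  shows "1 + z \<notin> \<real>\<^sub>\<le>\<^sub>0"
proof
  assume "1 + z \<in> \<real>\<^sub>\<le>\<^sub>0"
  hence "Re z \<le> -1"
    by (auto simp: complex_nonpos_Reals_iff)
  moreover have "\<bar>Re z\<bar> < 1"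
    using assms abs_Re_le_cmod[of z] by simp
  ultimately show False by linarith
qed

lemma B_denominator_nonzero:
  assumes "z \<in> \<bbbD>"
  shows "1 - Ln (1 + z) \<noteq> 0"
proof
  assume "1 - Ln (1 + z) = 0"
  hence 1: "Ln (1 + z) = 1" by simp
  have "1 + z \<noteq> 0"
    using one_plus_nonpos_Reals[OF assms] by auto
  hence "1 + z = exp 1"
    using 1 exp_Ln by metis
  hence "z = of_real (exp 1 - 1)"
    by (simp add: algebra_simps exp_of_real[symmetric] del: exp_of_real)
  hence "cmod z = exp 1 - 1"
    by (simp only: norm_of_real) simp
  moreover have "exp 1 \<ge> (2 :: real)"
    using exp_ge_add_one_self[of "1::real"] by simp
  ultimately show False
    using assms by simp
qed

lemma B_nonzero: "z \<in> \<bbbD> \<Longrightarrow> B z \<noteq> 0"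
  using B_denominator_nonzero by (simp add: B_def)

lemma B_holomorphic: "B holomorphic_on \<bbbD>"
  unfolding B_def using one_plus_nonpos_Reals B_denominator_nonzero
  by (intro holomorphic_intros) auto

text \<open>The subordination rules out the zeros of f at which the totalised quotient would be 0.\<close>

lemma starlike_B_nonzero:
  assumes "f \<in> starlike_B" "z \<in> \<bbbD> - {0}"
  shows "f z \<noteq> 0"
proof
  assume "f z = 0"
  obtain w where "w ` \<bbbD> \<subseteq> \<bbbD>" "\<forall>z\<in>\<bbbD>. zf'_over_f f z = B (w z)"
    using assms(1) by (auto simp: starlike_B_def subordinate_def)
  hence "zf'_over_f f z \<noteq> 0"
    using assms(2) B_nonzero by (metis DiffD1 image_subset_iff)
  thus False
    using \<open>f z = 0\<close> assms(2) by (simp add: zf'_over_f_def)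
qed

lemma log_branch:
  assumes "f \<in> class_A" "\<And>z. z \<in> \<bbbD> - {0} \<Longrightarrow> f z \<noteq> 0"
  shows "log_branch f holomorphic_on \<bbbD>"
    and "log_branch f 0 = 0"
    and "\<And>z. z \<in> \<bbbD> - {0} \<Longrightarrow> exp (log_branch f z) = f z / z"
proof -
  define g where "g = (\<lambda>z. if z = 0 then deriv f 0 else (f z - f 0) / (z - 0))"
  have f: "f holomorphic_on \<bbbD>" "f 0 = 0" "deriv f 0 = 1"
    using assms(1) by (auto simp: class_A_def)
  have "g holomorphic_on \<bbbD>"
    unfolding g_def using f(1) by (intro pole_lemma_open) auto
  moreover have "g z \<noteq> 0" if "z \<in> \<bbbD>" for z
    using assms(2)[of z] that f by (auto simp: g_def)
  ultimately obtain G where G: "G holomorphic_on \<bbbD>" "\<And>z. z \<in> \<bbbD> \<Longrightarrow> exp (G z) = g z"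
    using holomorphic_logarithm_exists[of "\<bbbD>" g 0] by auto
  have "exp (G 0) = 1"
    using G(2)[of 0] f by (simp add: g_def)
  hence "(\<lambda>z. G z - G 0) holomorphic_on \<bbbD> \<and> G 0 - G 0 = 0 \<and>
      (\<forall>z\<in>\<bbbD> - {0}. exp (G z - G 0) = f z / z)"
    using G f by (auto intro!: holomorphic_intros simp: exp_diff g_def)
  hence ex: "\<exists>F. F holomorphic_on \<bbbD> \<and> F 0 = 0 \<and> (\<forall>z\<in>\<bbbD> - {0}. exp (F z) = f z / z)"
    by (intro exI[of _ "\<lambda>z. G z - G 0"]) simp
  note * = someI_ex[OF ex, folded log_branch_def]
  show "log_branch f holomorphic_on \<bbbD>" "log_branch f 0 = 0"
    and "\<And>z. z \<in> \<bbbD> - {0} \<Longrightarrow> exp (log_branch f z) = f z / z"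
    using * by auto
qed

lemma log_coeff_sums:
  assumes "f \<in> starlike_B" "z \<in> \<bbbD>"
  shows "log_coeff f 0 = 0"
    and "(\<lambda>n. 2 * log_coeff f n * z ^ n) sums log_branch f z"
proof -
  have "f \<in> class_A"
    using assms(1) by (simp add: starlike_B_def)
  note lb = log_branch[OF this starlike_B_nonzero[OF assms(1)]]
  show "log_coeff f 0 = 0"
    using lb(2) by (simp add: log_coeff_def fps_expansion_def)
  show "(\<lambda>n. 2 * log_coeff f n * z ^ n) sums log_branch f z"
    using holomorphic_power_series[OF lb(1) assms(2)]
    by (simp add: log_coeff_def fps_expansion_def)
qed

end

theory Submission
  imports Defs
begin

text \<open>Write \<open>z f'(z) / f(z) = B(w(z))\<close> with a Schwarz function \<open>w\<close> whose Taylor coefficients are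
  \<open>c\<^sub>1, c\<^sub>2, c\<^sub>3, \<dots>\<close>. Since \<open>B' = B\<^sup>2 / (1 + z)\<close>, the function \<open>p = B \<circ> w\<close> satisfies
  \<open>(1 + w) p' = p\<^sup>2 w'\<close>, and comparing coefficients gives
  \<open>48 (\<gamma>\<^sub>1 \<gamma>\<^sub>3 - \<gamma>\<^sub>2\<^sup>2) = 4 c\<^sub>1 c\<^sub>3 + c\<^sub>1\<^sup>2 c\<^sub>2 + 7/12 c\<^sub>1\<^sup>4 - 3 c\<^sub>2\<^sup>2\<close>.
  Three steps of the Schur algorithm give \<open>c\<^sub>2 = (1 - \<bar>c\<^sub>1\<bar>\<^sup>2) x\<close> and
  \<open>c\<^sub>3 = (1 - \<bar>c\<^sub>1\<bar>\<^sup>2) ((1 - \<bar>x\<bar>\<^sup>2) y - cnj c\<^sub>1 x\<^sup>2)\<close> with \<open>x\<close>, \<open>y\<close> in the closed unit disc, after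
  which the triangle inequality bounds the right-hand side by 3. The choice \<open>w(z) = z\<^sup>2\<close> is
  extremal.\<close>

section \<open>Power series at 0 of functions on the disc\<close>

lemma holomorphic_unit_disc_has_fps_expansion:
  assumes "f holomorphic_on \<bbbD>"
  shows "f has_fps_expansion fps_expansion f 0"
  using has_fps_expansion_fps_expansion[OF open_ball _ assms] by simp

lemma has_fps_expansion_unique_on_unit_disc:
  fixes f g :: "complex \<Rightarrow> complex"
  assumes "f has_fps_expansion F" "g has_fps_expansion G" "\<And>z. z \<in> \<bbbD> \<Longrightarrow> f z = g z"
  shows "F = G"
proof -
  have "\<forall>\<^sub>F z in nhds 0. f z = g z"
    unfolding eventually_nhds by (rule exI[of _ "\<bbbD>"]) (use assms(3) in auto)
  hence "g has_fps_expansion F"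
    using assms(1) has_fps_expansion_cong by blast
  thus ?thesis
    using assms(2) fps_expansion_unique_complex by blast
qed

section \<open>The Schur algorithm and the first coefficients of a Schwarz function\<close>

text \<open>If \<phi> maps into the open disc, \<psi> is its Moebius transform sending
  \<open>\<phi> 0\<close> to 0, divided by \<open>z\<close>, and the Schwarz lemma bounds it.
  Otherwise the maximum principle makes \<phi> constant and \<psi> = 0 serves. The relation is
  multiplied out because \<open>1 - cnj (\<phi> 0) * \<phi> z\<close> vanishes in that second
  case.\<close>

lemma Schur_step:
  assumes holo: "\<phi> holomorphic_on \<bbbD>" and le: "\<And>z. z \<in> \<bbbD> \<Longrightarrow> cmod (\<phi> z) \<le> 1"
  obtains \<psi> where "\<psi> holomorphic_on \<bbbD>" "\<And>z. z \<in> \<bbbD> \<Longrightarrow> cmod (\<psi> z) \<le> 1"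
    "\<And>z. z \<in> \<bbbD> \<Longrightarrow> \<phi> z - \<phi> 0 = z * \<psi> z * (1 - cnj (\<phi> 0) * \<phi> z)"
proof (cases "\<exists>\<xi>\<in>\<bbbD>. cmod (\<phi> \<xi>) = 1")
  case True
  then obtain \<xi> where \<xi>: "\<xi> \<in> \<bbbD>" "cmod (\<phi> \<xi>) = 1"
    by blast
  have "\<phi> constant_on \<bbbD>"
    by (rule maximum_modulus_principle[OF holo _ _ _ _ \<xi>(1)]) (use le \<xi> in auto)
  hence "\<phi> z = \<phi> 0" if "z \<in> \<bbbD>" for z
    using that unfolding constant_on_def by (metis centre_in_ball zero_less_one)
  hence "\<phi> z - \<phi> 0 = z * 0 * (1 - cnj (\<phi> 0) * \<phi> z)" if "z \<in> \<bbbD>" for z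
    using that by (metis diff_self mult_zero_left mult_zero_right)
  thus ?thesis
    by (rule that[of "\<lambda>_. 0", rotated 2]) simp_all
next
  case False
  hence lt: "cmod (\<phi> z) < 1" if "z \<in> \<bbbD>" for z
    using le[OF that] that by force
  have lt0: "cmod (\<phi> 0) < 1"
    using lt by simp
  define M where "M = Moebius_function 0 (\<phi> 0) \<circ> \<phi>"
  have M_holo: "M holomorphic_on \<bbbD>"
    unfolding M_def using lt
    by (intro holomorphic_on_compose_gen[OF holo Moebius_function_holomorphic[OF lt0]]) auto
  have M_lt: "cmod (M z) < 1" if "cmod z < 1" for z
    unfolding M_def comp_def using lt[of z] that by (intro Moebius_function_norm_lt_1 lt0) auto
  have M0: "M 0 = 0"
    by (simp add: M_def Moebius_function_eq_zero)
  have M_eq: "\<phi> z - \<phi> 0 = M z * (1 - cnj (\<phi> 0) * \<phi> z)" if "z \<in> \<bbbD>" for z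
  proof -
    have "cmod (cnj (\<phi> 0) * \<phi> z) < 1"
      using norm_mult_less[of "cnj (\<phi> 0)" 1 "\<phi> z" 1] lt[OF that] lt0 by simp
    hence "1 - cnj (\<phi> 0) * \<phi> z \<noteq> 0"
      by auto
    thus ?thesis
      by (simp add: M_def Moebius_function_simple)
  qed
  \<comment> \<open>The value \<open>deriv M 0\<close> removes the singularity at 0. The two
    estimates of the Schwarz lemma bound the quotient and this value respectively.\<close>
  define \<psi> where "\<psi> = (\<lambda>z. if z = 0 then deriv M 0 else (M z - M 0) / (z - 0))"
  show ?thesis
  proof (rule that)
    show "\<psi> holomorphic_on \<bbbD>"
      unfolding \<psi>_def by (intro pole_lemma_open M_holo) auto
    show "cmod (\<psi> z) \<le> 1" if "z \<in> \<bbbD>" for z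
      using Schwarz_Lemma(1,2)[OF M_holo M0 M_lt, of z] that
      by (auto simp: \<psi>_def M0 norm_divide divide_le_eq_1)
    show "\<phi> z - \<phi> 0 = z * \<psi> z * (1 - cnj (\<phi> 0) * \<phi> z)" if "z \<in> \<bbbD>" for z
      using M_eq[OF that] by (simp add: \<psi>_def M0)
  qed
qed

text \<open>The factor \<open>fps_X\<close> makes the relation a recursion: each coefficient of
  \<open>\<Phi>\<close> depends only on earlier coefficients of \<open>\<Phi>\<close> and on those
  of \<psi>.\<close>

lemma Schur_step_fps:
  assumes holo: "\<phi> holomorphic_on \<bbbD>" and le: "\<And>z. z \<in> \<bbbD> \<Longrightarrow> cmod (\<phi> z) \<le> 1"
  defines "\<Phi> \<equiv> fps_expansion \<phi> 0"
  obtains \<psi> where "\<psi> holomorphic_on \<bbbD>" "\<And>z. z \<in> \<bbbD> \<Longrightarrow> cmod (\<psi> z) \<le> 1"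
    "\<Phi> = fps_const (\<phi> 0) +
       fps_X * fps_expansion \<psi> 0 * (1 - fps_const (cnj (\<phi> 0)) * \<Phi>)"
proof -
  obtain \<psi> where \<psi>: "\<psi> holomorphic_on \<bbbD>" "\<And>z. z \<in> \<bbbD> \<Longrightarrow> cmod (\<psi> z) \<le> 1"
    "\<And>z. z \<in> \<bbbD> \<Longrightarrow> \<phi> z - \<phi> 0 = z * \<psi> z * (1 - cnj (\<phi> 0) * \<phi> z)"
    using Schur_step[OF holo le] by blast
  have \<phi>_exp: "\<phi> has_fps_expansion \<Phi>"
    unfolding \<Phi>_def by (rule holomorphic_unit_disc_has_fps_expansion[OF holo])
  have "(\<lambda>z. \<phi> z - \<phi> 0) has_fps_expansion (\<Phi> - fps_const (\<phi> 0))"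
    by (intro fps_expansion_intros \<phi>_exp)
  moreover have "(\<lambda>z. z * \<psi> z * (1 - cnj (\<phi> 0) * \<phi> z)) has_fps_expansion
      fps_X * fps_expansion \<psi> 0 * (1 - fps_const (cnj (\<phi> 0)) * \<Phi>)"
    by (intro fps_expansion_intros \<phi>_exp holomorphic_unit_disc_has_fps_expansion \<psi>(1))
  ultimately have "\<Phi> - fps_const (\<phi> 0) =
      fps_X * fps_expansion \<psi> 0 * (1 - fps_const (cnj (\<phi> 0)) * \<Phi>)"
    using \<psi>(3) by (rule has_fps_expansion_unique_on_unit_disc)
  thus ?thesis
    using that[OF \<psi>(1,2)] by (simp add: algebra_simps)
qed

lemma fps_nth_fps_expansion_0 [simp]: "fps_nth (fps_expansion f 0) 0 = f 0"
  by (simp add: fps_expansion_def)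

text \<open>The Schur steps run through w, \<phi>, \<psi>, \<theta>, and the parameters are values
  at 0: \<open>c 1 = \<phi> 0\<close>, \<open>x = \<psi> 0\<close>,
  \<open>y = \<theta> 0\<close>.\<close>

lemma Schwarz_function_coeffs:
  assumes "w holomorphic_on \<bbbD>" "\<And>z. z \<in> \<bbbD> \<Longrightarrow> cmod (w z) \<le> 1" "w 0 = 0"
  defines "(c :: nat \<Rightarrow> complex) \<equiv> fps_nth (fps_expansion w 0)"
  obtains x y where "cmod (c 1) \<le> 1" "cmod x \<le> 1" "cmod y \<le> 1"
    "c 2 = of_real (1 - (cmod (c 1))\<^sup>2) * x"
    "c 3 = of_real (1 - (cmod (c 1))\<^sup>2) * (of_real (1 - (cmod x)\<^sup>2) * y - cnj (c 1) * x\<^sup>2)"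
proof -
  have mod_sq: "1 - cnj a * a = of_real (1 - (cmod a)\<^sup>2)" for a
    by (metis complex_norm_square mult.commute of_real_1 of_real_diff of_real_power)
  obtain \<phi> where \<phi>: "\<phi> holomorphic_on \<bbbD>" "\<And>z. z \<in> \<bbbD> \<Longrightarrow> cmod (\<phi> z) \<le> 1"
    and w: "fps_expansion w 0 = fps_const (w 0) +
       fps_X * fps_expansion \<phi> 0 * (1 - fps_const (cnj (w 0)) * fps_expansion w 0)"
    using Schur_step_fps[OF assms(1,2)] by blast
  define \<Phi> where "\<Phi> = fps_expansion \<phi> 0"
  \<comment> \<open>As \<open>w 0 = 0\<close>, the first step is division by z, which shifts every
    coefficient index by one.\<close>
  have w: "fps_expansion w 0 = fps_X * \<Phi>"
    using w assms(3) by (simp add: \<Phi>_def)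
  obtain \<psi> where \<psi>: "\<psi> holomorphic_on \<bbbD>" "\<And>z. z \<in> \<bbbD> \<Longrightarrow> cmod (\<psi> z) \<le> 1"
    and \<Phi>_eq: "\<Phi> = fps_const (\<phi> 0) +
       fps_X * fps_expansion \<psi> 0 * (1 - fps_const (cnj (\<phi> 0)) * \<Phi>)"
    using Schur_step_fps[OF \<phi>] unfolding \<Phi>_def by blast
  define \<Psi> where "\<Psi> = fps_expansion \<psi> 0"
  obtain \<theta> where \<theta>: "\<theta> holomorphic_on \<bbbD>" "\<And>z. z \<in> \<bbbD> \<Longrightarrow> cmod (\<theta> z) \<le> 1"
    and \<Psi>_eq: "\<Psi> = fps_const (\<psi> 0) +
       fps_X * fps_expansion \<theta> 0 * (1 - fps_const (cnj (\<psi> 0)) * \<Psi>)"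
    using Schur_step_fps[OF \<psi>] unfolding \<Psi>_def by blast
  have c: "c 1 = \<phi> 0" "c 2 = fps_nth \<Phi> 1" "c 3 = fps_nth \<Phi> 2"
    by (simp_all add: c_def w \<Phi>_def)
  \<comment> \<open>The recursion has its unknown series on both sides, so it is unfolded just once.
    The factor \<open>1 - cnj a * a\<close> in the coefficient of z is
    \<open>mod_sq\<close>.\<close>
  have \<Psi>1: "fps_nth \<Psi> 1 = of_real (1 - (cmod (\<psi> 0))\<^sup>2) * \<theta> 0"
    unfolding mod_sq[symmetric] by (subst \<Psi>_eq) (simp add: \<Psi>_def)
  have \<Phi>1: "fps_nth \<Phi> 1 = of_real (1 - (cmod (\<phi> 0))\<^sup>2) * \<psi> 0"
    unfolding mod_sq[symmetric] by (subst \<Phi>_eq) (simp add: \<Phi>_def)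
  have "fps_nth \<Phi> 2 = (1 - cnj (\<phi> 0) * \<phi> 0) * fps_nth \<Psi> 1 - cnj (\<phi> 0) * \<psi> 0 * fps_nth \<Phi> 1"
    by (subst \<Phi>_eq)
       (simp add: \<Psi>_def \<Phi>_def mult.assoc fps_mult_nth numeral_2_eq_2 algebra_simps)
  hence \<Phi>2: "fps_nth \<Phi> 2 =
      of_real (1 - (cmod (\<phi> 0))\<^sup>2) * (of_real (1 - (cmod (\<psi> 0))\<^sup>2) * \<theta> 0 - cnj (\<phi> 0) * (\<psi> 0)\<^sup>2)"
    unfolding mod_sq \<Phi>1 \<Psi>1 by (simp add: algebra_simps power2_eq_square)
  show ?thesis
    by (rule that[of "\<psi> 0" "\<theta> 0", unfolded c]) (use \<phi>(2) \<psi>(2) \<theta>(2) \<Phi>1 \<Phi>2 in auto)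
qed

section \<open>The estimate in terms of the Schur parameters\<close>

lemma Hankel_bound:
  fixes c x y :: complex
  assumes "cmod c \<le> 1" "cmod x \<le> 1" "cmod y \<le> 1"
  defines "c2 \<equiv> of_real (1 - (cmod c)\<^sup>2) * x"
    and "c3 \<equiv> of_real (1 - (cmod c)\<^sup>2) * (of_real (1 - (cmod x)\<^sup>2) * y - cnj c * x\<^sup>2)"
  shows "cmod (4 * c * c3 + c\<^sup>2 * c2 + 7 / 12 * c ^ 4 - 3 * c2\<^sup>2) \<le> 3"
proof -
  define a t where "a = cmod c" and "t = cmod x"
  have at: "0 \<le> a" "a \<le> 1" "0 \<le> t" "t \<le> 1"
    using assms by (auto simp: a_def t_def)
  have a2: "a\<^sup>2 \<le> 1" and t2: "t\<^sup>2 \<le> 1"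
    using at by (auto intro: power_le_one)
  have cc: "c * cnj c = of_real (a\<^sup>2)"
    by (simp only: a_def complex_norm_square)
  have "4 * c * c3 + c\<^sup>2 * c2 + 7 / 12 * c ^ 4 - 3 * c2\<^sup>2 =
      of_real (1 - a\<^sup>2) * (4 * of_real (1 - t\<^sup>2) * c * y - 4 * (c * cnj c) * x\<^sup>2
        - 3 * of_real (1 - a\<^sup>2) * x\<^sup>2 + c\<^sup>2 * x) + 7 / 12 * c ^ 4"
    unfolding c2_def c3_def a_def[symmetric] t_def[symmetric]
    by (simp add: algebra_simps power2_eq_square)
  \<comment> \<open>The two terms in \<open>x\<^sup>2\<close> merge, since 4 a^2 + 3 (1 - a^2) = 3 +
    a^2.\<close>
  also have "\<dots> = of_real (1 - a\<^sup>2) *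
      (of_real (4 * (1 - t\<^sup>2)) * (c * y) - of_real (3 + a\<^sup>2) * x\<^sup>2 + c\<^sup>2 * x) + 7 / 12 * c ^ 4"
    unfolding cc by (simp add: algebra_simps)
  also have "cmod \<dots> \<le> (1 - a\<^sup>2) * (4 * (1 - t\<^sup>2) * a + (3 + a\<^sup>2) * t\<^sup>2 + a\<^sup>2 * t) + 7 / 12 * a ^ 4"
  proof -
    have "cmod (of_real (4 * (1 - t\<^sup>2)) * (c * y)) \<le> 4 * (1 - t\<^sup>2) * a"
      using t2 at mult_left_mono[OF assms(3), of "4 * (1 - t\<^sup>2) * a"]
      by (simp only: norm_mult norm_of_real a_def[symmetric]) (simp add: mult.assoc)
    moreover have "cmod (of_real (3 + a\<^sup>2) * x\<^sup>2) = (3 + a\<^sup>2) * t\<^sup>2"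
      by (simp only: norm_mult norm_of_real norm_power t_def) simp
    moreover have "cmod (c\<^sup>2 * x) = a\<^sup>2 * t"
      by (simp add: norm_mult norm_power a_def t_def)
    ultimately have "cmod (of_real (4 * (1 - t\<^sup>2)) * (c * y) - of_real (3 + a\<^sup>2) * x\<^sup>2 + c\<^sup>2 * x)
        \<le> 4 * (1 - t\<^sup>2) * a + (3 + a\<^sup>2) * t\<^sup>2 + a\<^sup>2 * t"
      using norm_triangle_ineq4[of "of_real (4 * (1 - t\<^sup>2)) * (c * y)" "of_real (3 + a\<^sup>2) * x\<^sup>2"]
      by (intro order.trans[OF norm_triangle_ineq]) linarith
    moreover have "cmod (of_real (1 - a\<^sup>2)) = 1 - a\<^sup>2"
      using a2 by (simp only: norm_of_real)
    moreover have "cmod (7 / 12 * c ^ 4) = 7 / 12 * a ^ 4"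
      by (simp add: norm_mult norm_power a_def)
    ultimately show ?thesis
      using a2 by (intro order.trans[OF norm_triangle_ineq] add_mono)
        (simp_all only: norm_mult mult_left_mono diff_ge_0_iff_ge order.refl)
  qed
  \<comment> \<open>The bracket equals 4a + (1 - a)(3 - a) t^2 + a^2 t. It is nondecreasing in t on
    [0, 1], and its value at t = 1 is 3 + 2 a^2.\<close>
  also have "\<dots> \<le> (1 - a\<^sup>2) * (3 + 2 * a\<^sup>2) + 7 / 12 * a ^ 4"
  proof -
    have "(1 - a) * (3 - a) * t\<^sup>2 \<le> (1 - a) * (3 - a)"
      using mult_left_mono[OF t2, of "(1 - a) * (3 - a)"] at by simp
    moreover have "a\<^sup>2 * t \<le> a\<^sup>2"
      using mult_left_mono[OF at(4), of "a\<^sup>2"] by simp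
    ultimately have "4 * (1 - t\<^sup>2) * a + (3 + a\<^sup>2) * t\<^sup>2 + a\<^sup>2 * t \<le> 3 + 2 * a\<^sup>2"
      by (simp add: algebra_simps power2_eq_square)
    thus ?thesis
      using a2 by (simp add: mult_left_mono)
  qed
  also have "\<dots> = 3 - a\<^sup>2 - 17 / 12 * a ^ 4"
    by (simp add: algebra_simps power2_eq_square eval_nat_numeral)
  also have "\<dots> \<le> 3"
    using zero_le_power2[of a] zero_le_power[OF at(1), of 4] by linarith
  finally show ?thesis .
qed

section \<open>Logarithmic coefficients in terms of the Schwarz function\<close>

lemma B_has_field_derivative:
  assumes "z \<in> \<bbbD>"
  shows "(B has_field_derivative (B z)\<^sup>2 / (1 + z)) (at z)"
proof -
  have "1 + z \<noteq> 0"
    using one_plus_nonpos_Reals[OF assms] by auto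
  thus ?thesis
    unfolding B_def[abs_def]
    using one_plus_nonpos_Reals[OF assms] B_denominator_nonzero[OF assms]
    by (auto intro!: derivative_eq_intros simp: field_simps power2_eq_square)
qed

text \<open>This is logarithmic differentiation of \<open>f u = u * exp (F u)\<close>. At 0 it holds
  because \<open>zf'_over_f\<close> is given the value 1 there.\<close>

lemma zf'_over_f_eq_deriv_log_branch:
  assumes "f \<in> class_A" "\<And>z. z \<in> \<bbbD> - {0} \<Longrightarrow> f z \<noteq> 0" "z \<in> \<bbbD>"
  shows "zf'_over_f f z = 1 + z * deriv (log_branch f) z"
proof (cases "z = 0")
  case False
  define F where "F = log_branch f"
  note F = log_branch[OF assms(1,2), folded F_def]
  have f_eq: "f u = u * exp (F u)" if "u \<in> \<bbbD>" for u
    using F(3)[of u] that assms(1) by (cases "u = 0") (auto simp: class_A_def)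
  have dF: "(F has_field_derivative deriv F z) (at z)"
    using F(1) assms(3) by (intro holomorphic_derivI) auto
  have "((\<lambda>u. u * exp (F u)) has_field_derivative exp (F z) * (1 + z * deriv F z)) (at z)"
    by (rule derivative_eq_intros dF refl)+ (simp add: algebra_simps)
  hence "(f has_field_derivative exp (F z) * (1 + z * deriv F z)) (at z)"
    by (rule has_field_derivative_transform_within_open[of _ _ _ "\<bbbD>"]) (use assms f_eq in auto)
  hence "deriv f z = exp (F z) * (1 + z * deriv F z)"
    by (rule DERIV_imp_deriv)
  thus ?thesis
    using False f_eq[OF assms(3)] by (simp add: zf'_over_f_def F_def)
qed (simp add: zf'_over_f_def)

text \<open>The first product has denominator 12 and the square has denominator 16 in front of
  polynomials in the c's; 48 is their least common multiple.\<close>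

lemma log_coeff_Hankel:
  assumes "f \<in> starlike_B" "w holomorphic_on \<bbbD>" "w ` \<bbbD> \<subseteq> \<bbbD>" "w 0 = 0"
    and eq: "\<And>z. z \<in> \<bbbD> \<Longrightarrow> zf'_over_f f z = B (w z)"
  defines "(c :: nat \<Rightarrow> complex) \<equiv> fps_nth (fps_expansion w 0)"
  shows "48 * (log_coeff f 1 * log_coeff f 3 - (log_coeff f 2)\<^sup>2) =
    4 * c 1 * c 3 + (c 1)\<^sup>2 * c 2 + 7 / 12 * c 1 ^ 4 - 3 * (c 2)\<^sup>2"
proof -
  have A: "f \<in> class_A"
    using assms(1) by (simp add: starlike_B_def)
  define F p where "F = log_branch f" and "p = (\<lambda>z. 1 + z * deriv F z)"
  define \<Phi> P W where "\<Phi> = fps_expansion F 0" and "P = 1 + fps_X * fps_deriv \<Phi>"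
    and "W = fps_expansion w 0"
  have F: "F holomorphic_on \<bbbD>"
    unfolding F_def by (rule log_branch[OF A starlike_B_nonzero[OF assms(1)]])
  have p_eq: "p z = B (w z)" if "z \<in> \<bbbD>" for z
    using zf'_over_f_eq_deriv_log_branch[OF A starlike_B_nonzero[OF assms(1)] that] eq[OF that]
    by (simp add: p_def F_def)
  have W: "w has_fps_expansion W"
    unfolding W_def by (rule holomorphic_unit_disc_has_fps_expansion[OF assms(2)])
  have P: "p has_fps_expansion P"
    unfolding p_def P_def \<Phi>_def
    by (intro fps_expansion_intros holomorphic_unit_disc_has_fps_expansion F)
  \<comment> \<open>In this form neither the logarithm nor a quotient is left, so both sides expand
    as products of formal power series.\<close>
  have ode: "(1 + w z) * deriv p z = p z * p z * deriv w z" if "z \<in> \<bbbD>" for z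
  proof -
    have wz: "w z \<in> \<bbbD>"
      using assms(3) that by blast
    have "(w has_field_derivative deriv w z) (at z)"
      using assms(2) that by (intro holomorphic_derivI) auto
    hence "((\<lambda>u. B (w u)) has_field_derivative (B (w z))\<^sup>2 / (1 + w z) * deriv w z) (at z)"
      by (intro DERIV_chain2[where f = B] B_has_field_derivative wz)
    hence "(p has_field_derivative (B (w z))\<^sup>2 / (1 + w z) * deriv w z) (at z)"
      by (rule has_field_derivative_transform_within_open[of _ _ _ "\<bbbD>"]) (use that p_eq in auto)
    moreover have "1 + w z \<noteq> 0"
      using one_plus_nonpos_Reals[OF wz] by auto
    ultimately show ?thesis
      using p_eq[OF that] by (simp add: DERIV_imp_deriv power2_eq_square)
  qed
  have "(\<lambda>z. (1 + w z) * deriv p z) has_fps_expansion (1 + W) * fps_deriv P"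
    "(\<lambda>z. p z * p z * deriv w z) has_fps_expansion P * P * fps_deriv W"
    by (intro fps_expansion_intros P W)+
  hence "(1 + W) * fps_deriv P = P * P * fps_deriv W"
    using ode by (rule has_fps_expansion_unique_on_unit_disc)
  hence n: "fps_nth ((1 + W) * fps_deriv P) k = fps_nth (P * P * fps_deriv W) k" for k
    by simp
  define g where "g = log_coeff f"
  have \<Phi>: "fps_nth \<Phi> k = 2 * g k" for k
    by (simp add: g_def log_coeff_def \<Phi>_def F_def)
  \<comment> \<open>From \<open>p z = 1 + z * deriv F z\<close>, the k-th coefficient for k > 0 is k
    times that of \<open>F\<close>, hence 2k times the k-th logarithmic coefficient.\<close>
  have P_nth: "fps_nth P 0 = 1" "fps_nth P (Suc 0) = 2 * g 1" "fps_nth P (Suc (Suc 0)) = 4 * g 2"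
    "fps_nth P (Suc (Suc (Suc 0))) = 6 * g 3"
    by (simp_all add: P_def \<Phi> eval_nat_numeral)
  have W_nth: "fps_nth W 0 = 0" "fps_nth W (Suc 0) = c 1" "fps_nth W (Suc (Suc 0)) = c 2"
    "fps_nth W (Suc (Suc (Suc 0))) = c 3"
    using assms(4) by (simp_all add: W_def c_def eval_nat_numeral)
  \<comment> \<open>The derivative lowers the index by one: the coefficients of order 0, 1, 2 in the
    equation yield those of \<open>P\<close> of order 1, 2, 3, each using the previous ones.\<close>
  have P1: "fps_nth P (Suc 0) = c 1"
    using n[of 0] by (simp add: P_nth(1) W_nth)
  have P2: "fps_nth P (Suc (Suc 0)) = c 2 + (c 1)\<^sup>2 / 2"
    using n[of "Suc 0"]
    by (simp add: P_nth(1) P1 W_nth fps_mult_nth power2_eq_square field_simps)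
  have P3: "fps_nth P (Suc (Suc (Suc 0))) = c 3 + c 1 * c 2 + (c 1) ^ 3 / 3"
    using n[of "Suc (Suc 0)"]
    by (simp add: P_nth(1) P1 W_nth fps_mult_nth power2_eq_square power3_eq_cube field_simps)
  have g: "g 1 = c 1 / 2" "g 2 = (c 2 + (c 1)\<^sup>2 / 2) / 4"
    "g 3 = (c 3 + c 1 * c 2 + (c 1) ^ 3 / 3) / 6"
    using P_nth(2) P1 P_nth(3) P2 P_nth(4) P3 by simp_all
  show ?thesis
    unfolding g_def[symmetric] g
    by (simp add: field_simps power2_eq_square power3_eq_cube power4_eq_xxxx)
qed

section \<open>Construction of a function from a given Schwarz function\<close>

text \<open>The equation for f is integrated: log (f(z) / z) must have derivative (B(w(z)) - 1) / z,
  which extends holomorphically to 0 because B(w(0)) = 1.\<close>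

lemma starlike_B_exists:
  assumes w: "w holomorphic_on \<bbbD>" "w ` \<bbbD> \<subseteq> \<bbbD>" "w 0 = 0"
  obtains f where "f \<in> starlike_B" "\<And>z. z \<in> \<bbbD> \<Longrightarrow> zf'_over_f f z = B (w z)"
proof -
  define b where "b = (\<lambda>z. B (w z))"
  have b: "b holomorphic_on \<bbbD>" "b 0 = 1"
    using holomorphic_on_compose_gen[OF w(1) B_holomorphic] w(2,3)
    by (auto simp: b_def comp_def B_def)
  define q where "q = (\<lambda>z. if z = 0 then deriv b 0 else (b z - b 0) / (z - 0))"
  have "q holomorphic_on \<bbbD>"
    unfolding q_def by (intro pole_lemma_open b) auto
  then obtain G where "\<And>z. z \<in> \<bbbD> \<Longrightarrow> (G has_field_derivative q z) (at z within \<bbbD>)"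
    using holomorphic_convex_primitive'[of "\<bbbD>" q] by auto
  hence dG: "(G has_field_derivative q z) (at z)" if "z \<in> \<bbbD>" for z
    using that by (metis at_within_open open_ball)
  \<comment> \<open>Subtracting \<open>G 0\<close> makes the exponential equal to 1 at 0, which
    gives \<open>deriv f 0 = 1\<close>.\<close>
  define f where "f = (\<lambda>z. z * exp (G z - G 0))"
  have df: "(f has_field_derivative exp (G z - G 0) * b z) (at z)" if "z \<in> \<bbbD>" for z
  proof -
    have "(f has_field_derivative exp (G z - G 0) * (1 + z * q z)) (at z)"
      unfolding f_def
      by (rule derivative_eq_intros dG[OF that] refl)+ (simp add: algebra_simps)
    thus ?thesis
      using b(2) by (simp add: q_def split: if_splits)
  qed
  have f_holo: "f holomorphic_on \<bbbD>"
    using df by (subst holomorphic_on_open) blast+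
  have deriv_f: "deriv f z = exp (G z - G 0) * b z" if "z \<in> \<bbbD>" for z
    using df[OF that] by (rule DERIV_imp_deriv)
  have eq: "zf'_over_f f z = b z" if "z \<in> \<bbbD>" for z
    using that b(2) by (simp add: zf'_over_f_def deriv_f) (simp add: f_def)
  have "f \<in> class_A"
    using f_holo deriv_f[of 0] b(2) by (simp add: class_A_def f_def)
  moreover have "zf'_over_f f holomorphic_on \<bbbD>"
    using b(1) eq by (metis holomorphic_transform)
  ultimately have "f \<in> starlike_B"
    using w eq B_holomorphic by (auto simp: starlike_B_def subordinate_def b_def)
  thus ?thesis
    using that eq by (simp add: b_def)
qed

section \<open>The bound 1/16 and its sharpness\<close>

theorem theorem3p5:
  shows "(\<forall>f\<in>starlike_B. cmod (log_coeff f 1 * log_coeff f 3 - (log_coeff f 2)\<^sup>2) \<le> 1 / 16) \<and>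
         (\<exists>f\<in>starlike_B. cmod (log_coeff f 1 * log_coeff f 3 - (log_coeff f 2)\<^sup>2) = 1 / 16)"
proof (intro conjI ballI)
  fix f
  assume f: "f \<in> starlike_B"
  then obtain w where w: "w holomorphic_on \<bbbD>" "w ` \<bbbD> \<subseteq> \<bbbD>" "w 0 = 0"
    and eq: "\<And>z. z \<in> \<bbbD> \<Longrightarrow> zf'_over_f f z = B (w z)"
    by (auto simp: starlike_B_def subordinate_def)
  have w_le: "cmod (w z) \<le> 1" if "z \<in> \<bbbD>" for z
    using w(2) that by (force intro: less_imp_le)
  define c where "c = fps_nth (fps_expansion w 0)"
  obtain x y where "cmod (c 1) \<le> 1" "cmod x \<le> 1" "cmod y \<le> 1"
    "c 2 = of_real (1 - (cmod (c 1))\<^sup>2) * x"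
    "c 3 = of_real (1 - (cmod (c 1))\<^sup>2) * (of_real (1 - (cmod x)\<^sup>2) * y - cnj (c 1) * x\<^sup>2)"
    using Schwarz_function_coeffs[OF w(1) w_le w(3)] unfolding c_def by blast
  hence "cmod (4 * c 1 * c 3 + (c 1)\<^sup>2 * c 2 + 7 / 12 * c 1 ^ 4 - 3 * (c 2)\<^sup>2) \<le> 3"
    using Hankel_bound[of "c 1" x y] by simp
  hence "cmod (48 * (log_coeff f 1 * log_coeff f 3 - (log_coeff f 2)\<^sup>2)) \<le> 3"
    using log_coeff_Hankel[OF f w eq] by (simp add: c_def)
  thus "cmod (log_coeff f 1 * log_coeff f 3 - (log_coeff f 2)\<^sup>2) \<le> 1 / 16"
    by (simp only: norm_mult norm_numeral)
next
  \<comment> \<open>Here c1 = c3 = 0 and c2 = 1, so only the term -3 c2^2 survives and the modulus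
    is 3/48 = 1/16. In the Schur parameters this is c = 0, x = 1, where the estimates above become
    equalities.\<close>
  define w :: "complex \<Rightarrow> complex" where "w = (\<lambda>z. z\<^sup>2)"
  have w: "w holomorphic_on \<bbbD>" "w ` \<bbbD> \<subseteq> \<bbbD>" "w 0 = 0"
    by (auto simp: w_def norm_power power_less_one_iff intro!: holomorphic_intros)
  obtain f where f: "f \<in> starlike_B" and eq: "\<And>z. z \<in> \<bbbD> \<Longrightarrow> zf'_over_f f z = B (w z)"
    using starlike_B_exists[OF w] by blast
  have "fps_expansion w 0 = fps_X ^ 2"
    unfolding w_def by (intro fps_expansion_eqI fps_expansion_intros)
  hence "48 * (log_coeff f 1 * log_coeff f 3 - (log_coeff f 2)\<^sup>2) = - 3"
    using log_coeff_Hankel[OF f w eq] by (simp add: fps_X_power_iff)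
  hence "cmod (48 * (log_coeff f 1 * log_coeff f 3 - (log_coeff f 2)\<^sup>2)) = 3"
    by (simp only: norm_minus_cancel norm_numeral)
  hence "cmod (log_coeff f 1 * log_coeff f 3 - (log_coeff f 2)\<^sup>2) = 1 / 16"
    by (simp only: norm_mult norm_numeral)
  thus "\<exists>f\<in>starlike_B. cmod (log_coeff f 1 * log_coeff f 3 - (log_coeff f 2)\<^sup>2) = 1 / 16"
    using f by blast
qed

end
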